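(* Let $\rho_1,\rho_2,\rho_3$ be any three pure states on an arbitrary finite-dimensional complex Hilbert space $\mathcal H$, and let $\beta=F(\{1,2,3\})-F(\{1,2\})-F(\{1,3\})-F(\{2,3\})$. Then $$\beta\le\frac{3\sqrt3}{2}-2.$$ Equality holds only for a qubit trine embedded in $\mathcal H$, up to unitary conjugation and permutation of the states.
   Context: A pure state is a rank-one density matrix $|\psi\rangle\langle\psi|$ with $\psi$ a unit vector. For density matrices $\rho_1,\rho_2,\rho_3$ and nonempty $H\subseteq\{1,2,3\}$, the minimum unnormalized discrimination error is $F(H)=|H|-D(H)$, where $D(H)=\max\sum_{i\in H}\operatorname{Tr}(\rho_iM_i)$, the maximum over all POVMs $(M_i)_{i\in H}$ (i.e. $M_i\ge0$, $\sum_{i\in H}M_i=\mathbb I$). The qubit trine is the triple of pure states on $\mathbb C^2$ given by $\frac12(\mathbb I+\vec r_i\cdot\vec\sigma)$ ($\vec\sigma$ the vector of Pauli matrices) with Bloch vectors $\vec r_1=(1,0,0)$, $\vec r_2=(-1/2,\sqrt3/2,0)$, $\vec r_3=(-1/2,-\sqrt3/2,0)$; embedded in $\mathcal H$ means transported to a two-dimensional subspace of $\mathcal H$ by an isometry $\mathbb C^2\to\mathcal H$. *)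

theory Defs
  imports "HOL-Analysis.Analysis"
begin

text \<open>The Hilbert space is \<open>complex ^ 'n\<close> with inner product conjugate-linear in the first
  argument; its norm is the library norm on \<open>complex ^ 'n\<close>. A linear map from
  \<open>complex ^ 'm\<close> to \<open>complex ^ 'n\<close> is a matrix of type \<open>complex ^ 'm ^ 'n\<close>.\<close>
definition cinner :: "complex ^ 'n \<Rightarrow> complex ^ 'n \<Rightarrow> complex"
  where "cinner u v = (\<Sum>i\<in>UNIV. cnj (u $ i) * v $ i)"

definition dagger :: "complex ^ 'm ^ 'n \<Rightarrow> complex ^ 'n ^ 'm"
  where "dagger A = (\<chi> i j. cnj (A $ j $ i))"

definition psd :: "complex ^ 'n ^ 'n \<Rightarrow> bool"
  where "psd A \<longleftrightarrow> dagger A = A \<and> (\<forall>v. 0 \<le> Re (cinner v (A *v v)))"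

definition isometry :: "complex ^ 'm ^ 'n \<Rightarrow> bool"
  where "isometry V \<longleftrightarrow> dagger V ** V = mat 1"

definition unitary :: "complex ^ 'n ^ 'n \<Rightarrow> bool"
  where "unitary U \<longleftrightarrow> dagger U ** U = mat 1 \<and> U ** dagger U = mat 1"

definition ketbra :: "complex ^ 'n \<Rightarrow> complex ^ 'n ^ 'n"
  where "ketbra \<psi> = (\<chi> i j. \<psi> $ i * cnj (\<psi> $ j))"

definition pure_state :: "complex ^ 'n ^ 'n \<Rightarrow> bool"
  where "pure_state \<rho> \<longleftrightarrow> (\<exists>\<psi>. norm \<psi> = 1 \<and> \<rho> = ketbra \<psi>)"

definition povm :: "'i set \<Rightarrow> ('i \<Rightarrow> complex ^ 'n ^ 'n) \<Rightarrow> bool"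
  where "povm H M \<longleftrightarrow> (\<forall>i\<in>H. psd (M i)) \<and> (\<Sum>i\<in>H. M i) = mat 1"

text \<open>The traces below are real for Hermitian \<open>\<rho> i\<close> and \<open>M i\<close>, so \<^const>\<open>Re\<close> discards
  nothing.\<close>
definition success :: "('i \<Rightarrow> complex ^ 'n ^ 'n) \<Rightarrow> 'i set \<Rightarrow> ('i \<Rightarrow> complex ^ 'n ^ 'n) \<Rightarrow> real"
  where "success \<rho> H M = (\<Sum>i\<in>H. Re (trace (\<rho> i ** M i)))"

text \<open>For finite nonempty \<open>H\<close> the supremum is a maximum; see \<open>max_success_attained\<close> and
  \<open>success_le_max_success\<close> below.\<close>
definition max_success :: "('i \<Rightarrow> complex ^ 'n ^ 'n) \<Rightarrow> 'i set \<Rightarrow> real"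
  where "max_success \<rho> H = (SUP M\<in>{M. povm H M}. success \<rho> H M)"

definition min_error :: "('i \<Rightarrow> complex ^ 'n ^ 'n) \<Rightarrow> 'i set \<Rightarrow> real"
  where "min_error \<rho> H = real (card H) - max_success \<rho> H"

definition pauli_x :: "complex ^ 2 ^ 2"
  where "pauli_x = vector [vector [0, 1], vector [1, 0]]"

definition pauli_y :: "complex ^ 2 ^ 2"
  where "pauli_y = vector [vector [0, - \<i>], vector [\<i>, 0]]"

definition pauli_z :: "complex ^ 2 ^ 2"
  where "pauli_z = vector [vector [1, 0], vector [0, - 1]]"

definition bloch_state :: "real ^ 3 \<Rightarrow> complex ^ 2 ^ 2"
  where "bloch_state r =
    (1 / 2) *\<^sub>R (mat 1 + r $ 1 *\<^sub>R pauli_x + r $ 2 *\<^sub>R pauli_y + r $ 3 *\<^sub>R pauli_z)"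

text \<open>Only the indices 1, 2, 3 are meaningful.\<close>
definition trine_bloch :: "nat \<Rightarrow> real ^ 3"
  where "trine_bloch i =
    (if i = 1 then vector [1, 0, 0]
     else if i = 2 then vector [- 1 / 2, sqrt 3 / 2, 0]
     else vector [- 1 / 2, - sqrt 3 / 2, 0])"

definition trine :: "nat \<Rightarrow> complex ^ 2 ^ 2"
  where "trine i = bloch_state (trine_bloch i)"

lemma psd_zero: "psd 0"
  by (simp add: psd_def dagger_def cinner_def vec_eq_iff)

lemma psd_one: "psd (mat 1 :: complex ^ 'n ^ 'n)"
proof -
  have "0 \<le> Re (cinner v v)" for v :: "complex ^ 'n"
    unfolding cinner_def by (auto intro!: sum_nonneg)
  moreover have "dagger (mat 1 :: complex ^ 'n ^ 'n) = mat 1"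
    by (auto simp: dagger_def mat_def vec_eq_iff)
  ultimately show ?thesis by (simp add: psd_def)
qed

lemma povm_exists:
  assumes "finite H" "H \<noteq> {}"
  shows "\<exists>M :: 'i \<Rightarrow> complex ^ 'n ^ 'n. povm H M"
proof -
  obtain h where "h \<in> H" using assms by blast
  then have "povm H (\<lambda>i. if i = h then mat 1 else 0 :: complex ^ 'n ^ 'n)"
    using assms by (auto simp: povm_def psd_zero psd_one)
  then show ?thesis by blast
qed

lemma psd_diag:
  assumes "psd A" shows "0 \<le> Re (A $ i $ i)"
proof -
  have "cinner (axis i 1) (A *v axis i 1) = A $ i $ i"
  proof -
    have "cinner (axis i 1) (A *v axis i 1) = (\<Sum>k\<in>UNIV. if k = i then A $ i $ i else 0)"
      unfolding cinner_def
      by (rule sum.cong) (auto simp: axis_def matrix_vector_mult_def if_distrib cong: if_cong)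
    then show ?thesis by simp
  qed
  with assms show ?thesis unfolding psd_def by metis
qed

lemma cinner_axis2:
  assumes "i \<noteq> j"
  shows "cinner (axis i 1 + axis j c) (A *v (axis i 1 + axis j c)) =
    A $ i $ i + c * A $ i $ j + cnj c * A $ j $ i + cnj c * c * A $ j $ j"
proof -
  have Av: "(A *v (axis i 1 + axis j c)) $ k = A $ k $ i + A $ k $ j * c" for k
  proof -
    have "(A *v (axis i 1 + axis j c)) $ k =
        (\<Sum>l\<in>UNIV. (if l = i then A $ k $ i else 0) + (if l = j then A $ k $ j * c else 0))"
      unfolding matrix_vector_mult_def vec_lambda_beta
      by (rule sum.cong) (use assms in \<open>auto simp: axis_def\<close>)
    then show ?thesis by (simp add: sum.distrib)
  qed
  have "cinner (axis i 1 + axis j c) w = w $ i + cnj c * w $ j" for w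
  proof -
    have "cinner (axis i 1 + axis j c) w =
        (\<Sum>l\<in>UNIV. (if l = i then w $ i else 0) + (if l = j then cnj c * w $ j else 0))"
      unfolding cinner_def
      by (rule sum.cong) (use assms in \<open>auto simp: axis_def\<close>)
    then show ?thesis by (simp add: sum.distrib)
  qed
  then show ?thesis by (simp only: Av) (simp add: algebra_simps)
qed

lemma psd_entry_bound:
  assumes "psd A" shows "2 * cmod (A $ i $ j) \<le> Re (A $ i $ i) + Re (A $ j $ j)"
proof (cases "i = j \<or> A $ i $ j = 0")
  case True
  have herm: "cnj (A $ i $ i) = A $ i $ i" for i
    using assms by (auto simp: psd_def dagger_def vec_eq_iff)
  then have "Im (A $ i $ i) = 0" for i by (metis complex_cnj cnj.simps(2) equal_neg_zero)
  then have "cmod (A $ i $ i) = \<bar>Re (A $ i $ i)\<bar>" for i by (simp add: cmod_def)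
  with True psd_diag[OF assms] show ?thesis by fastforce
next
  case False
  define a where "a = A $ i $ j"
  define c where "c = - cnj a / of_real (cmod a)"
  have a0: "cmod a \<noteq> 0" using False a_def by simp
  have "dagger A $ j $ i = A $ j $ i" using assms by (simp add: psd_def)
  then have ji: "A $ j $ i = cnj a" by (simp add: dagger_def a_def)
  have aa: "a * cnj a = of_real (cmod a) * of_real (cmod a)"
    using complex_norm_square[of a] by (simp add: power2_eq_square)
  have ca: "c * a = - of_real (cmod a)"
    using a0 aa by (simp add: c_def field_simps)
  then have "cnj (c * a) = - of_real (cmod a)" by simp
  then have ca': "cnj c * cnj a = - of_real (cmod a)" by simp
  have cc: "cnj c * c = 1"
    using a0 aa by (simp add: c_def field_simps)
  have "0 \<le> Re (cinner (axis i 1 + axis j c) (A *v (axis i 1 + axis j c)))"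
    using assms by (simp add: psd_def)
  also have "cinner (axis i 1 + axis j c) (A *v (axis i 1 + axis j c)) =
      A $ i $ i - of_real (cmod a) - of_real (cmod a) + A $ j $ j"
    using False by (simp add: cinner_axis2 ji ca' cc ca flip: a_def)
  finally show ?thesis by (simp add: a_def)
qed

lemma povm_entry_bound:
  assumes "finite H" "povm H M" "h \<in> H"
  shows "cmod (M h $ i $ j) \<le> 1"
proof -
  have diag: "Re (M h $ k $ k) \<le> 1" for k
  proof -
    have "Re (M h $ k $ k) \<le> (\<Sum>l\<in>H. Re (M l $ k $ k))"
      by (rule member_le_sum) (use assms psd_diag in \<open>auto simp: povm_def\<close>)
    also have "\<dots> = Re ((\<Sum>l\<in>H. M l) $ k $ k)" by simp
    also have "\<dots> = 1" using assms by (simp add: povm_def mat_def)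
    finally show ?thesis .
  qed
  have "psd (M h)" using assms by (simp add: povm_def)
  from psd_entry_bound[OF this, of i j] diag[of i] diag[of j] show ?thesis by linarith
qed

lemma closed_psd: "closed {A :: complex ^ 'n ^ 'n. psd A}"
  unfolding psd_def dagger_def cinner_def matrix_vector_mult_def
  by (intro closed_Collect_conj closed_Collect_all closed_Collect_eq closed_Collect_le
      continuous_intros continuous_on_vec_lambda)

lemma compact_povm:
  assumes "finite H"
  shows "compact {M :: 'i \<Rightarrow> complex ^ 'n ^ 'n. povm H M \<and> (\<forall>i. i \<notin> H \<longrightarrow> M i = 0)}"
    (is "compact ?S")
proof -
  define K :: "(complex ^ 'n ^ 'n) set" where "K = {A. \<forall>i j. cmod (A $ i $ j) \<le> 1}"
  have "closed K" unfolding K_def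
    by (intro closed_Collect_all closed_Collect_le continuous_intros)
  moreover have "bounded K"
  proof -
    have "norm A \<le> (\<Sum>i\<in>(UNIV::'n set). \<Sum>j\<in>(UNIV::'n set). 1)" if "A \<in> K" for A
    proof -
      have "norm A \<le> (\<Sum>i\<in>UNIV. norm (A $ i))" by (simp add: norm_vec_def L2_set_le_sum)
      also have "\<dots> \<le> (\<Sum>i\<in>UNIV. \<Sum>j\<in>UNIV. norm (A $ i $ j))"
        by (intro sum_mono) (simp add: norm_vec_def L2_set_le_sum)
      also have "\<dots> \<le> (\<Sum>i\<in>(UNIV::'n set). \<Sum>j\<in>(UNIV::'n set). 1)"
        using that by (intro sum_mono) (auto simp: K_def)
      finally show ?thesis .
    qed
    then show ?thesis by (auto simp: bounded_iff)
  qed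
  ultimately have "compact K" using compact_eq_bounded_closed by blast
  then have "compactin (product_topology (\<lambda>_::'i. euclidean) UNIV) (PiE UNIV (\<lambda>_. K))"
    by (subst compactin_PiE) auto
  then have cK: "compact (PiE UNIV (\<lambda>_::'i. K))"
    by (simp add: euclidean_product_topology)
  have coord: "continuous_on UNIV (\<lambda>M :: 'i \<Rightarrow> complex ^ 'n ^ 'n. M i)" for i
    by (rule continuous_on_product_coordinates)
  have "closed {M :: 'i \<Rightarrow> complex ^ 'n ^ 'n. psd (M i)}" for i
    using closed_vimage[OF closed_psd coord[of i]] by (simp add: vimage_def)
  then have cS: "closed ?S"
    unfolding povm_def Ball_def
    by (intro closed_Collect_conj closed_Collect_all closed_Collect_imp open_Collect_const
        closed_Collect_eq coord continuous_on_sum continuous_on_const)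
  have "?S \<subseteq> PiE UNIV (\<lambda>_. K)"
  proof
    fix M assume M: "M \<in> ?S"
    have "cmod (M h $ i $ j) \<le> 1" for h i j
      using M povm_entry_bound[OF assms, of M h i j] by (cases "h \<in> H") auto
    then show "M \<in> PiE UNIV (\<lambda>_. K)" by (auto simp: K_def)
  qed
  then show ?thesis using compact_Int_closed[OF cK cS] by (simp add: Int_absorb1)
qed

lemma success_has_max:
  fixes \<rho> :: "'i \<Rightarrow> complex ^ 'n ^ 'n"
  assumes "finite H" "H \<noteq> {}"
  shows "\<exists>M. povm H M \<and> (\<forall>N. povm H N \<longrightarrow> success \<rho> H N \<le> success \<rho> H M)"
proof -
  let ?S = "{M :: 'i \<Rightarrow> complex ^ 'n ^ 'n. povm H M \<and> (\<forall>i. i \<notin> H \<longrightarrow> M i = 0)}"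
  define cut where "cut M i = (if i \<in> H then M i else 0)"
    for M :: "'i \<Rightarrow> complex ^ 'n ^ 'n" and i
  have cut: "cut M \<in> ?S" "success \<rho> H (cut M) = success \<rho> H M" if "povm H M" for M
    using that by (auto simp: cut_def povm_def success_def)
  have ne: "?S \<noteq> {}" using povm_exists[OF assms] cut by blast
  have cont: "continuous_on ?S (success \<rho> H)"
    unfolding success_def trace_def matrix_matrix_mult_def vec_lambda_beta
    by (intro continuous_intros continuous_on_subset[OF continuous_on_product_coordinates]) auto
  obtain M where "M \<in> ?S" "\<forall>N\<in>?S. success \<rho> H N \<le> success \<rho> H M"
    using continuous_attains_sup[OF compact_povm[OF assms(1)] ne cont] by blast
  then show ?thesis using cut by (metis (no_types, lifting) mem_Collect_eq)
qed

lemma success_le_max_success: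
  fixes \<rho> :: "'i \<Rightarrow> complex ^ 'n ^ 'n"
  assumes "finite H" "povm H M"
  shows "success \<rho> H M \<le> max_success \<rho> H"
proof -
  have "H \<noteq> {}"
  proof
    assume "H = {}"
    then have "(0 :: complex ^ 'n ^ 'n) = mat 1" using assms by (simp add: povm_def)
    then have "(0 :: complex ^ 'n ^ 'n) $ i $ i = mat 1 $ i $ i" for i by simp
    then show False by (simp add: mat_def)
  qed
  then have "bdd_above (success \<rho> H ` {M. povm H M})"
    using success_has_max[OF assms(1)] by (metis (no_types, lifting) bdd_aboveI2 mem_Collect_eq)
  then show ?thesis unfolding max_success_def using assms by (intro cSUP_upper) auto
qed

lemma max_success_attained:
  fixes \<rho> :: "'i \<Rightarrow> complex ^ 'n ^ 'n"
  assumes "finite H" "H \<noteq> {}"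
  shows "\<exists>M. povm H M \<and> success \<rho> H M = max_success \<rho> H"
proof -
  obtain M where M: "povm H M" "\<forall>N. povm H N \<longrightarrow> success \<rho> H N \<le> success \<rho> H M"
    using success_has_max[OF assms] by blast
  have "max_success \<rho> H \<le> success \<rho> H M"
    unfolding max_success_def using M by (intro cSUP_least) auto
  then show ?thesis using M(1) success_le_max_success[OF assms(1) M(1), of \<rho>] by (intro exI[of _ M]) simp
qed

end

theory Submission
  imports Defs "HOL-Computational_Algebra.Fundamental_Theorem_Algebra"
begin

text \<open>Write \<open>c\<^sub>i\<^sub>j\<close> for the inner products of the three state vectors,
  \<open>s\<^sub>i\<^sub>j = sqrt (1 - |c\<^sub>i\<^sub>j|\<^sup>2)\<close>, and \<open>G\<close> for the Gram matrix. Two states are discriminated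
  with success at most \<open>1 + s\<^sub>i\<^sub>j\<close>. For three states the pretty good measurement, whose outcome
  amplitudes form the positive square root \<open>X\<close> of \<open>G\<close>, has success \<open>\<Sum>\<^sub>i X\<^sub>i\<^sub>i\<^sup>2 \<ge> (tr X)\<^sup>2 / 3\<close>. Hence
  \<open>\<beta> \<le> s\<^sub>1\<^sub>2 + s\<^sub>1\<^sub>3 + s\<^sub>2\<^sub>3 - (tr X)\<^sup>2 / 3\<close>, and \<open>s\<^sub>1\<^sub>2\<^sup>2 + s\<^sub>1\<^sub>3\<^sup>2 + s\<^sub>2\<^sub>3\<^sup>2 = e\<^sub>2(G)\<close> is determined by the
  eigenvalues of \<open>X\<close>. What remains is an inequality between three nonnegative reals, a
  consequence of Schur's inequality of degree four. Equality forces all \<open>|c\<^sub>i\<^sub>j| = 1/2\<close> and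
  \<open>det G = 0\<close>, so the triple product of the \<open>c\<^sub>i\<^sub>j\<close> is \<open>-1/8\<close> and suitable phases make the
  three vectors sum to zero.

  The square root of \<open>G\<close> is obtained without a spectral theorem: \<open>U ** A\<close> is positive
  semidefinite as soon as the unitary \<open>U\<close> maximizes \<open>Re (trace (U ** A))\<close>.\<close>

section \<open>Inner products, unitaries and rank-one operators\<close>

lemma cinner_add_left: "cinner (u + v) w = cinner u w + cinner v w"
  by (simp add: cinner_def algebra_simps sum.distrib)

lemma cinner_add_right: "cinner w (u + v) = cinner w u + cinner w v"
  by (simp add: cinner_def algebra_simps sum.distrib)

lemma cinner_diff_left: "cinner (u - v) w = cinner u w - cinner v w"
  by (simp add: cinner_def algebra_simps sum_subtractf)

lemma cinner_diff_right: "cinner w (u - v) = cinner w u - cinner w v"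
  by (simp add: cinner_def algebra_simps sum_subtractf)

lemma cinner_scale_left: "cinner (c *s u) v = cnj c * cinner u v"
  by (simp add: cinner_def sum_distrib_left mult_ac)

lemma cinner_scale_right: "cinner u (c *s v) = c * cinner u v"
  by (simp add: cinner_def sum_distrib_left mult_ac)

lemma cinner_zero_left [simp]: "cinner 0 v = 0"
  by (simp add: cinner_def)

lemma cinner_zero_right [simp]: "cinner v 0 = 0"
  by (simp add: cinner_def)

lemma cinner_sum_left: "cinner (\<Sum>i\<in>S. f i) v = (\<Sum>i\<in>S. cinner (f i) v)"
  by (induction S rule: infinite_finite_induct) (simp_all add: cinner_add_left)

lemma cinner_sum_right: "cinner v (\<Sum>i\<in>S. f i) = (\<Sum>i\<in>S. cinner v (f i))"
  by (induction S rule: infinite_finite_induct) (simp_all add: cinner_add_right)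

lemmas cinner_simps = cinner_add_left cinner_add_right cinner_diff_left cinner_diff_right
  cinner_scale_left cinner_scale_right

lemma cnj_cinner: "cnj (cinner u v) = cinner v u"
  by (simp add: cinner_def mult.commute)

lemma cinner_self: "cinner v v = of_real ((norm v)\<^sup>2)"
proof -
  have "(norm v)\<^sup>2 = (\<Sum>i\<in>UNIV. (cmod (v $ i))\<^sup>2)"
    by (simp add: norm_vec_def L2_set_def sum_nonneg)
  then have "complex_of_real ((norm v)\<^sup>2) = (\<Sum>i\<in>UNIV. of_real ((cmod (v $ i))\<^sup>2))"
    by (simp only: of_real_sum)
  also have "\<dots> = cinner v v"
    unfolding cinner_def complex_norm_square by (simp add: mult.commute)
  finally show ?thesis by simp
qed

lemma cinner_eq_zero_iff: "cinner v v = 0 \<longleftrightarrow> v = 0"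
  unfolding cinner_self of_real_eq_0_iff by simp

lemma norm_vector_scale: "norm (c *s v) = cmod c * norm (v :: complex ^ 'n)"
proof -
  have "complex_of_real ((norm (c *s v))\<^sup>2) = cnj c * c * cinner v v"
    by (simp only: cinner_self[symmetric] cinner_scale_left cinner_scale_right mult_ac)
  also have "\<dots> = of_real ((cmod c * norm v)\<^sup>2)"
    using complex_norm_square[of c] by (simp add: cinner_self power_mult_distrib mult_ac)
  finally have "(norm (c *s v))\<^sup>2 = (cmod c * norm v)\<^sup>2"
    by (simp only: of_real_eq_iff)
  then show ?thesis by (simp add: power2_eq_iff_nonneg)
qed

lemma cinner_dagger: "cinner u (A *v v) = cinner (dagger A *v u) v"
proof -
  have "cinner u (A *v v) = (\<Sum>i\<in>UNIV. \<Sum>j\<in>UNIV. cnj (u $ i) * (A $ i $ j * v $ j))"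
    by (simp add: cinner_def matrix_vector_mult_def sum_distrib_left)
  also have "\<dots> = (\<Sum>j\<in>UNIV. \<Sum>i\<in>UNIV. cnj (u $ i) * (A $ i $ j * v $ j))"
    by (rule sum.swap)
  also have "\<dots> = cinner (dagger A *v u) v"
    by (simp add: cinner_def matrix_vector_mult_def dagger_def sum_distrib_left sum_distrib_right mult_ac)
  finally show ?thesis .
qed

lemma dagger_mult: "dagger (A ** B) = dagger B ** dagger A"
  by (simp add: dagger_def matrix_matrix_mult_def vec_eq_iff mult.commute)

lemma unitaryI: "dagger U ** U = mat 1 \<Longrightarrow> unitary U"
  unfolding unitary_def using matrix_left_right_inverse by blast

lemma unitary_one: "unitary (mat 1 :: complex ^ 'n ^ 'n)"
proof (rule unitaryI)
  have "dagger (mat 1 :: complex ^ 'n ^ 'n) = mat 1"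
    using psd_one[where ?'n = 'n] unfolding psd_def by blast
  then show "dagger (mat 1) ** mat 1 = (mat 1 :: complex ^ 'n ^ 'n)" by simp
qed

lemma unitary_mult:
  assumes "unitary U" "unitary V" shows "unitary (U ** V)"
proof (rule unitaryI)
  have "dagger (U ** V) ** (U ** V) = dagger V ** (dagger U ** U) ** V"
    by (simp add: dagger_mult matrix_mul_assoc)
  then show "dagger (U ** V) ** (U ** V) = mat 1"
    using assms by (simp add: unitary_def)
qed

lemma norm_unitary:
  assumes "unitary U" shows "norm (U *v v) = norm v"
proof -
  have "cinner (U *v v) (U *v v) = cinner v v"
    using assms by (simp add: cinner_dagger matrix_vector_mul_assoc unitary_def)
  then have "(norm (U *v v))\<^sup>2 = (norm v)\<^sup>2"
    by (simp only: cinner_self of_real_eq_iff)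
  then show ?thesis by (simp add: power2_eq_iff_nonneg)
qed

lemma ketbra_mult_vec: "ketbra m *v v = cinner m v *s m"
  by (simp add: ketbra_def matrix_vector_mult_def cinner_def vec_eq_iff sum_distrib_left mult_ac)

lemma ketbra_phase: "cmod c = 1 \<Longrightarrow> ketbra (c *s v) = ketbra v"
proof -
  assume "cmod c = 1"
  then have "c * cnj c = 1" by (simp add: complex_norm_square[symmetric])
  then show ?thesis
    by (simp add: ketbra_def vec_eq_iff)
qed

lemma dagger_ketbra: "dagger (ketbra v) = ketbra v"
  by (simp add: dagger_def ketbra_def vec_eq_iff mult.commute)

lemma conjugate_ketbra: "A ** ketbra v ** dagger A = ketbra (A *v v)"
proof -
  have "(A ** ketbra v ** dagger A) $ i $ j = ketbra (A *v v) $ i $ j" for i j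
  proof -
    have "(A ** ketbra v) $ i $ k = (A *v v) $ i * cnj (v $ k)" for k
      by (simp add: matrix_matrix_mult_def matrix_vector_mult_def ketbra_def sum_distrib_right mult.assoc)
    then show ?thesis
      by (subst matrix_matrix_mult_def)
        (simp add: dagger_def ketbra_def matrix_vector_mult_def sum_distrib_left mult_ac)
  qed
  then show ?thesis by (simp add: vec_eq_iff)
qed

lemma ketbra_form: "cinner v (ketbra m *v v) = of_real ((cmod (cinner m v))\<^sup>2)"
  using cnj_cinner[of m v]
  by (simp add: ketbra_mult_vec cinner_scale_right complex_norm_square del: of_real_power)

lemma psd_ketbra: "psd (ketbra m)"
  by (simp add: psd_def dagger_ketbra ketbra_form)

lemma psd_add: "psd A \<Longrightarrow> psd B \<Longrightarrow> psd (A + B)"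
  by (simp add: psd_def dagger_def vec_eq_iff matrix_vector_mult_add_rdistrib cinner_add_right)

lemma trace_ketbra_mult: "trace (ketbra v ** A) = cinner v (A *v v)"
  unfolding trace_def matrix_matrix_mult_def ketbra_def cinner_def matrix_vector_mult_def
    vec_lambda_beta sum_distrib_left
  by (subst sum.swap) (simp add: mult_ac)

section \<open>Discriminating two states\<close>

text \<open>For Hermitian \<open>M\<close> the left-hand side is \<open>Re \<langle>a - b, M (a + b)\<rangle>\<close>. Since \<open>c\<close> is real,
  \<open>a - b\<close> and \<open>a + b\<close> are orthogonal for the real inner product; rescaling them by \<open>s\<close> and
  \<open>1 / s\<close> to equal length makes the polarization identity sharp.\<close>
lemma psd_diff_form_le:
  assumes M: "psd M" and le: "\<And>v. Re (cinner v (M *v v)) \<le> (norm v)\<^sup>2"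
    and a: "norm a = 1" and b: "norm b = 1" and ab: "cinner a b = of_real c"
  shows "Re (cinner a (M *v a)) - Re (cinner b (M *v b)) \<le> sqrt (1 - c\<^sup>2)"
proof -
  have ba: "cinner b a = of_real c" using cnj_cinner[of a b] ab by simp
  have aa: "cinner a a = 1" and bb: "cinner b b = 1" by (simp_all add: cinner_self a b)
  show ?thesis
  proof (cases "c = 1 \<or> c = -1")
    case True
    \<comment> \<open>In this case \<open>a\<close> and \<open>b\<close> are parallel and no
      rescaling can equalize the lengths of \<open>a - b\<close> and \<open>a + b\<close>; the two
      forms simply coincide.\<close>
    have "cinner (a - of_real c *s b) (a - of_real c *s b) = 0"
      using True aa bb by (auto simp: cinner_simps ab ba)
    then have "a - of_real c *s b = 0" by (simp only: cinner_eq_zero_iff)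
    then have "a = of_real c *s b" by simp
    then have "cinner a (M *v a) = cinner b (M *v b)"
      using True by (auto simp: cinner_simps matrix_vector_mult_scaleR vector_scalar_commute)
    then show ?thesis using True by auto
  next
    case False
    have herm: "cinner v (M *v w) = cnj (cinner w (M *v v))" for v w
      using M cinner_dagger[of v M w] by (simp add: psd_def cnj_cinner)
    have "0 \<le> Re (cinner (a - b) (a - b))" "0 \<le> Re (cinner (a + b) (a + b))"
      by (simp_all only: cinner_self Re_complex_of_real zero_le_power2)
    then have "c \<le> 1" "-1 \<le> c" by (simp_all add: cinner_simps ab ba aa bb)
    with False have c: "c < 1" "-1 < c" by auto
    \<comment> \<open>The equal-length condition reads s^2 (2 - 2 c) = (2 + 2 c) / s^2.\<close>
    define s where "s = root 4 ((1 + c) / (1 - c))"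
    have s: "s > 0" "s ^ 4 = (1 + c) / (1 - c)" using c by (simp_all add: s_def)
    define u v where "u = of_real s *s (a - b)" and "v = of_real (1 / s) *s (a + b)"
    have "4 * Re (cinner u (M *v v)) = Re (cinner (u + v) (M *v (u + v))) - Re (cinner (u - v) (M *v (u - v)))"
      using herm[of v u] by (simp add: matrix_vector_right_distrib matrix_vector_mult_diff_distrib cinner_simps)
    also have "\<dots> \<le> (norm (u + v))\<^sup>2"
      using le[of "u + v"] M by (simp add: psd_def add_increasing2 diff_le_eq)
    also have "\<dots> = Re (cinner (u + v) (u + v))"
      by (simp only: cinner_self Re_complex_of_real)
    also have "\<dots> = s\<^sup>2 * (2 - 2 * c) + (2 + 2 * c) / s\<^sup>2"
      using s(1) by (simp add: u_def v_def cinner_simps aa bb ab ba field_simps power2_eq_square)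
    also have "\<dots> = 4 * sqrt (1 - c\<^sup>2)"
    proof -
      have s2: "s\<^sup>2 = sqrt ((1 + c) / (1 - c))"
        using s by (intro real_sqrt_unique[symmetric]) auto
      have "s\<^sup>2 * (2 - 2 * c) = 2 * sqrt (1 - c\<^sup>2)" 
      proof -
        have "sqrt (1 - c\<^sup>2) = sqrt (1 + c) * sqrt (1 - c)"
          by (simp add: real_sqrt_mult[symmetric] algebra_simps power2_eq_square)
        moreover define x where "x = sqrt (1 - c)"
        have x: "1 - c = x * x" "x \<noteq> 0" using c by (simp_all add: x_def)
        have "s\<^sup>2 * (2 - 2 * c) = 2 * (sqrt (1 + c) / x * (1 - c))"
          by (simp add: s2 real_sqrt_divide x_def algebra_simps)
        then have "s\<^sup>2 * (2 - 2 * c) = 2 * (sqrt (1 + c) * x)" using x by simp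
        ultimately show ?thesis by (simp add: x_def)
      qed
      moreover have "(2 + 2 * c) / s\<^sup>2 = s\<^sup>2 * (2 - 2 * c)"
      proof -
        have "s\<^sup>2 * s\<^sup>2 = (1 + c) / (1 - c)" using s(2) by simp
        then show ?thesis using c s(1) by (simp add: field_simps)
      qed
      ultimately show ?thesis by simp
    qed
    finally have "Re (cinner u (M *v v)) \<le> sqrt (1 - c\<^sup>2)" by simp
    moreover have "cinner u (M *v v) = cinner (a - b) (M *v (a + b))"
      unfolding u_def v_def vector_scalar_commute cinner_scale_left cinner_scale_right
      using s(1) by simp
    moreover have "Re (cinner (a - b) (M *v (a + b))) = Re (cinner a (M *v a)) - Re (cinner b (M *v b))"
      using herm[of a b] by (simp add: matrix_vector_right_distrib cinner_simps)
    ultimately show ?thesis by simp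
  qed
qed

lemma real_phase: "\<exists>w. cmod w = 1 \<and> w * z = of_real (cmod z)"
proof (cases "z = 0")
  case False
  then have "cmod (cnj z / of_real (cmod z)) = 1" "cnj z / of_real (cmod z) * z = of_real (cmod z)"
    using complex_norm_square[of z] by (simp_all add: norm_divide field_simps power2_eq_square)
  then show ?thesis by blast
qed (auto intro: exI[of _ 1])

text \<open>The upper half of Helstrom's formula. Since \<open>M j\<close> is the complement of
  \<open>M i\<close>, the success equals 1 plus the difference of the forms of \<open>M i\<close> at
  \<open>a\<close> and \<open>b\<close>. A phase on \<open>b\<close> makes the inner product real
  and leaves its projector unchanged.\<close>

lemma max_success_pair_le:
  fixes a b :: "complex ^ 'n"
  assumes "i \<noteq> j" "\<rho> i = ketbra a" "\<rho> j = ketbra b" "norm a = 1" "norm b = 1"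
  shows "max_success \<rho> {i, j} \<le> 1 + sqrt (1 - (cmod (cinner a b))\<^sup>2)"
proof -
  obtain M where M: "povm {i, j} M" "success \<rho> {i, j} M = max_success \<rho> {i, j}"
    using max_success_attained[of "{i, j}" \<rho>] by auto
  have psd: "psd (M i)" "psd (M j)" and sum: "M i + M j = mat 1"
    using M(1) assms(1) by (auto simp: povm_def)
  have form: "Re (cinner v (M i *v v)) + Re (cinner v (M j *v v)) = (norm v)\<^sup>2" for v
  proof -
    have "cinner v (M i *v v) + cinner v (M j *v v) = cinner v ((M i + M j) *v v)"
      by (simp add: matrix_vector_mult_add_rdistrib cinner_add_right)
    also have "\<dots> = of_real ((norm v)\<^sup>2)" by (simp add: sum cinner_self)
    finally show ?thesis by (metis Re_complex_of_real plus_complex.sel(1))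
  qed
  obtain w where w: "cmod w = 1" "w * cinner a b = of_real (cmod (cinner a b))"
    using real_phase by blast
  have "Re (cinner a (M i *v a)) - Re (cinner (w *s b) (M i *v (w *s b)))
      \<le> sqrt (1 - (cmod (cinner a b))\<^sup>2)"
  proof (rule psd_diff_form_le[OF psd(1)])
    show "Re (cinner v (M i *v v)) \<le> (norm v)\<^sup>2" for v
      using form[of v] psd(2) by (smt (verit) psd_def)
  qed (use assms w in \<open>auto simp: norm_vector_scale cinner_scale_right\<close>)
  moreover have "cinner (w *s b) (M i *v (w *s b)) = cinner b (M i *v b)"
    using trace_ketbra_mult[of "w *s b" "M i"] trace_ketbra_mult[of b "M i"] ketbra_phase[OF w(1), of b]
    by simp
  moreover have "success \<rho> {i, j} M = Re (cinner a (M i *v a)) + Re (cinner b (M j *v b))"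
    using assms(1-3) by (simp add: success_def trace_ketbra_mult)
  ultimately show ?thesis using form[of b] M(2) assms(5) by simp
qed

section \<open>Polar decomposition and square roots of Gram matrices\<close>

lemma trace_outer_mult: "trace ((\<chi> i j. x $ i * cnj (v $ j)) ** A) = cinner v (A *v x)"
  unfolding trace_def matrix_matrix_mult_def cinner_def matrix_vector_mult_def
    vec_lambda_beta sum_distrib_left
  by (subst sum.swap) (simp add: mult_ac)

lemma outer_mult_vec: "(\<chi> i j. x $ i * cnj (v $ j)) *v y = cinner v y *s x"
  by (simp add: matrix_vector_mult_def cinner_def vec_eq_iff sum_distrib_left mult_ac)

lemma dagger_dagger: "dagger (dagger A) = A"
  by (simp add: dagger_def vec_eq_iff)

text \<open>The operator multiplies \<open>v\<close> by \<open>w\<close> and fixes the orthogonal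
  complement of \<open>v\<close>. Inner products are preserved because the correction term is |w|^2
  = 1 expanded around w = 1.\<close>

lemma unitary_reflection:
  fixes v :: "complex ^ 'n"
  assumes v: "norm v = 1" and w: "cmod w = 1"
  shows "unitary (mat 1 + (\<chi> i j. ((w - 1) *s v) $ i * cnj (v $ j)))" (is "unitary ?U")
proof (rule unitaryI)
  have U: "?U *v x = x + (cinner v x * (w - 1)) *s v" for x
    by (simp only: matrix_vector_mult_add_rdistrib outer_mult_vec matrix_vector_mul_lid
        vector_smult_assoc)
  have "w * cnj w = 1" using w by (simp add: complex_norm_square[symmetric])
  then have w1: "(w - 1) + cnj (w - 1) + (w - 1) * cnj (w - 1) = 0" by (simp add: algebra_simps)
  have "cinner (?U *v x) (?U *v y) = cinner x y" for x y
  proof -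
    have "cinner (?U *v x) (?U *v y) = cinner x y
        + cinner x v * cinner v y * ((w - 1) + cnj (w - 1) + (w - 1) * cnj (w - 1))"
      unfolding U by (simp add: cinner_simps cnj_cinner cinner_self v del: complex_cnj_diff)
        (simp add: algebra_simps cnj_cinner)
    then show ?thesis unfolding w1 by simp
  qed
  then have iso: "cinner x ((dagger ?U ** ?U) *v y) = cinner x y" for x y
    using cinner_dagger[of "?U *v x" ?U y] cinner_dagger[of x "dagger ?U" "?U *v y"]
    by (simp only: dagger_dagger matrix_vector_mul_assoc[symmetric])
  have "(dagger ?U ** ?U) *v y = y" for y
  proof -
    have "cinner ((dagger ?U ** ?U) *v y - y) ((dagger ?U ** ?U) *v y - y) = 0"
      unfolding cinner_diff_right iso by simp
    then show ?thesis by (simp add: cinner_eq_zero_iff)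
  qed
  then show "dagger ?U ** ?U = mat 1" by (simp add: matrix_eq)
qed

lemma matrix_vector_mult_axis: "(A *v axis j 1) $ i = (A $ i $ j :: 'a :: semiring_1)"
proof -
  have "(A *v axis j 1) $ i = (\<Sum>k\<in>UNIV. if k = j then A $ i $ j else 0)"
    unfolding matrix_vector_mult_def vec_lambda_beta by (rule sum.cong) (auto simp: axis_def)
  then show ?thesis by simp
qed

text \<open>Polarization: basis vectors give real diagonal entries, and sums of two of them with
  coefficients 1 and \<open>\<i>\<close> compare the imaginary and real parts of opposite
  entries.\<close>

lemma hermitian_if_form_real:
  assumes "\<And>v. Im (cinner v (A *v v)) = 0"
  shows "dagger A = A"
proof -
  have diag: "Im (A $ i $ i) = 0" for i
  proof -
    have "cinner (axis i 1) w = w $ i" for w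
    proof -
      have "cinner (axis i 1) w = (\<Sum>k\<in>UNIV. if k = i then w $ i else 0)"
        unfolding cinner_def by (rule sum.cong) (auto simp: axis_def)
      then show ?thesis by simp
    qed
    then show ?thesis
      using assms[of "axis i 1"] by (simp add: matrix_vector_mult_axis)
  qed
  have "cnj (A $ j $ i) = A $ i $ j" for i j
  proof (cases "i = j")
    case True
    then show ?thesis using diag[of i] by (simp add: complex_eq_iff)
  next
    case False
    have "Im (A $ i $ j) + Im (A $ j $ i) = 0"
      using assms[of "axis i 1 + axis j 1"] diag[of i] diag[of j] by (simp add: cinner_axis2[OF False])
    moreover have "Re (A $ i $ j) - Re (A $ j $ i) = 0"
      using assms[of "axis i 1 + axis j \<i>"] diag[of i] diag[of j] by (simp add: cinner_axis2[OF False])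
    ultimately show ?thesis by (simp add: complex_eq_iff)
  qed
  then show ?thesis by (simp add: dagger_def vec_eq_iff)
qed

lemma matrix_add_mult_distrib: "(A + B) ** C = A ** C + B ** (C :: complex ^ 'n ^ 'm)"
  by (simp add: matrix_matrix_mult_def vec_eq_iff sum.distrib distrib_right)

text \<open>Testing maximality against the unitaries \<open>1 + (w - 1) |v\<rangle>\<langle>v|\<close> with \<open>|w| = 1\<close> gives
  \<open>|\<langle>v, A v\<rangle>| \<le> Re \<langle>v, A v\<rangle>\<close>.\<close>
lemma psd_if_trace_maximal:
  assumes max: "\<And>U. unitary U \<Longrightarrow> Re (trace (U ** A)) \<le> Re (trace A)"
  shows "psd A"
proof -
  have unit: "of_real (cmod (cinner v (A *v v))) = cinner v (A *v v)" if v: "norm v = 1" for v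
  proof -
    let ?z = "cinner v (A *v v)"
    \<comment> \<open>This phase turns the form value into its modulus, which makes the test against
      maximality as strong as possible.\<close>
    obtain w where w: "cmod w = 1" "w * ?z = of_real (cmod ?z)" using real_phase by blast
    let ?R = "(\<chi> i j. ((w - 1) *s v) $ i * cnj (v $ j))"
    have "trace ((mat 1 + ?R) ** A) = trace A + (w - 1) * ?z"
      by (simp only: matrix_add_mult_distrib matrix_mul_lid trace_add trace_outer_mult
          vector_scalar_commute cinner_scale_right)
    then have "Re ((w - 1) * ?z) \<le> 0"
      using max[OF unitary_reflection[OF v w(1)]] by simp
    then have "cmod ?z \<le> Re ?z" using w(2) by (simp add: left_diff_distrib)
    then have "Re ?z = cmod ?z" using complex_Re_le_cmod[of ?z] by linarith
    moreover from this have "Im ?z = 0" using cmod_power2[of ?z] by simp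
    ultimately show ?thesis by (simp add: complex_eq_iff)
  qed
  have form: "of_real (cmod (cinner v (A *v v))) = cinner v (A *v v)" for v
  proof (cases "v = 0")
    case False
    define u where "u = of_real (1 / norm v) *s v"
    have v: "v = of_real (norm v) *s u"
      using False by (simp add: u_def vec_eq_iff)
    have "norm u = 1" using False by (simp add: u_def norm_vector_scale norm_divide)
    from unit[OF this] show ?thesis
      apply (subst (1 2 3 4) v)
      by (simp add: vector_scalar_commute cinner_simps norm_mult)
  qed simp
  then have "Im (cinner v (A *v v)) = 0" "0 \<le> Re (cinner v (A *v v))" for v
    by (metis Im_complex_of_real, metis Re_complex_of_real norm_ge_zero)
  then show ?thesis using hermitian_if_form_real by (auto simp: psd_def)
qed

lemma compact_unitary: "compact {U :: complex ^ 'n ^ 'n. unitary U}"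
proof -
  have "closed {U :: complex ^ 'n ^ 'n. unitary U}"
    unfolding unitary_def dagger_def matrix_matrix_mult_def
    by (intro closed_Collect_conj closed_Collect_eq continuous_intros continuous_on_vec_lambda)
  moreover have "bounded {U :: complex ^ 'n ^ 'n. unitary U}"
  proof -
    have "norm U \<le> (\<Sum>i\<in>(UNIV::'n set). \<Sum>j\<in>(UNIV::'n set). 1)"
      if U: "unitary U" for U :: "complex ^ 'n ^ 'n"
    proof -
      have "cmod (U $ i $ j) \<le> 1" for i j
      proof -
        have "cmod (U $ i $ j) = cmod ((U *v axis j 1) $ i)"
          by (simp add: matrix_vector_mult_axis)
        also have "\<dots> \<le> norm (U *v axis j 1)" by (rule Finite_Cartesian_Product.norm_nth_le)
        also have "\<dots> = 1" by (simp add: norm_unitary[OF U])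
        finally show ?thesis .
      qed
      then have "(\<Sum>i\<in>UNIV. \<Sum>j\<in>UNIV. norm (U $ i $ j)) \<le> (\<Sum>i\<in>(UNIV::'n set). \<Sum>j\<in>(UNIV::'n set). 1)"
        by (intro sum_mono)
      moreover have "norm U \<le> (\<Sum>i\<in>UNIV. norm (U $ i))" by (simp add: norm_vec_def L2_set_le_sum)
      moreover have "(\<Sum>i\<in>UNIV. norm (U $ i)) \<le> (\<Sum>i\<in>UNIV. \<Sum>j\<in>UNIV. norm (U $ i $ j))"
        by (intro sum_mono) (simp add: norm_vec_def L2_set_le_sum)
      ultimately show ?thesis by linarith
    qed
    then show ?thesis by (auto simp: bounded_iff)
  qed
  ultimately show ?thesis using compact_eq_bounded_closed by blast
qed

text \<open>A maximizer of the real trace exists because the unitary group is compact. Left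
  multiplication by a further unitary stays inside the group, so the product is trace-maximal and
  hence positive semidefinite.\<close>

lemma polar_decomposition:
  fixes A :: "complex ^ 'n ^ 'n"
  shows "\<exists>U. unitary U \<and> psd (U ** A)"
proof -
  have "continuous_on {U. unitary U} (\<lambda>U. Re (trace (U ** A)))"
    unfolding trace_def matrix_matrix_mult_def vec_lambda_beta by (intro continuous_intros)
  then obtain U where U: "unitary U"
    and max: "\<And>V. unitary V \<Longrightarrow> Re (trace (V ** A)) \<le> Re (trace (U ** A))"
    using continuous_attains_sup[OF compact_unitary, of "\<lambda>U. Re (trace (U ** A))"] unitary_one
    by (metis (no_types, lifting) empty_iff mem_Collect_eq)
  have "psd (U ** A)"
    using max[OF unitary_mult[OF _ U]] by (intro psd_if_trace_maximal) (simp add: matrix_mul_assoc)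
  with U show ?thesis by blast
qed

definition orthonormal_or_zero :: "'i set \<Rightarrow> ('i \<Rightarrow> complex ^ 'n) \<Rightarrow> bool"
  where "orthonormal_or_zero S e \<longleftrightarrow>
    (\<forall>i\<in>S. \<forall>j\<in>S. i \<noteq> j \<longrightarrow> cinner (e i) (e j) = 0) \<and> (\<forall>i\<in>S. e i = 0 \<or> norm (e i) = 1)"

lemma cinner_expansion:
  assumes "finite S" "orthonormal_or_zero S e" "i \<in> S"
  shows "cinner (e i) (\<Sum>k\<in>S. cinner (e k) v *s e k) = cinner (e i) v"
proof -
  have "cinner (e i) (\<Sum>k\<in>S. cinner (e k) v *s e k) =
      (\<Sum>k\<in>S. if k = i then cinner (e i) v * cinner (e i) (e i) else 0)"
    unfolding cinner_sum_right cinner_scale_right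
    by (rule sum.cong) (use assms in \<open>auto simp: orthonormal_or_zero_def\<close>)
  also have "\<dots> = cinner (e i) v"
    using assms by (auto simp: orthonormal_or_zero_def cinner_self)
  finally show ?thesis .
qed

lemma gram_schmidt:
  fixes \<psi> :: "'i \<Rightarrow> complex ^ 'n"
  assumes "finite S"
  shows "\<exists>e. orthonormal_or_zero S e \<and> (\<forall>j\<in>S. \<psi> j = (\<Sum>k\<in>S. cinner (e k) (\<psi> j) *s e k))"
  using assms
proof (induction S)
  case empty
  then show ?case by (simp add: orthonormal_or_zero_def)
next
  case (insert x S)
  then obtain e where e: "orthonormal_or_zero S e"
    and span: "\<And>j. j \<in> S \<Longrightarrow> \<psi> j = (\<Sum>k\<in>S. cinner (e k) (\<psi> j) *s e k)" by blast
  define w where "w = \<psi> x - (\<Sum>k\<in>S. cinner (e k) (\<psi> x) *s e k)"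
  define u where "u = of_real (inverse (norm w)) *s w"
  define e' where "e' = e(x := u)"
  have ew: "cinner (e i) w = 0" if "i \<in> S" for i
    using cinner_expansion[OF insert(1) e that] by (simp add: w_def cinner_diff_right)
  then have eu: "cinner (e i) u = 0" if "i \<in> S" for i
    using that by (simp add: u_def cinner_scale_right)
  then have ue: "cinner u (e i) = 0" if "i \<in> S" for i
    using that cnj_cinner[of "e i" u] by simp
  have u: "u = 0 \<or> norm u = 1"
    by (cases "w = 0") (simp_all add: u_def norm_vector_scale norm_inverse)
  have e'S: "e' k = e k" if "k \<in> S" for k using that insert(2) by (auto simp: e'_def)
  have e'x: "e' x = u" by (simp add: e'_def)
  have "orthonormal_or_zero (insert x S) e'"
    using e eu ue u e'S e'x by (auto simp: orthonormal_or_zero_def)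
  moreover have "\<psi> j = (\<Sum>k\<in>insert x S. cinner (e' k) (\<psi> j) *s e' k)" if j: "j \<in> insert x S" for j
  proof -
    have split: "(\<Sum>k\<in>insert x S. cinner (e' k) (\<psi> j) *s e' k) =
        cinner u (\<psi> j) *s u + (\<Sum>k\<in>S. cinner (e k) (\<psi> j) *s e k)"
      using insert(1,2) by (simp add: e'x e'S)
    have ue_sum: "cinner u (\<Sum>k\<in>S. c k *s e k) = 0" for c
      using ue by (simp add: cinner_sum_right cinner_scale_right)
    show ?thesis
    proof (cases "j \<in> S")
      case True
      have "cinner u (\<psi> j) = 0" by (subst span[OF True]) (rule ue_sum)
      then show ?thesis using span[OF True] split by simp
    next
      case False
      with j have jx: "j = x" by simp
      have "\<psi> x = w + (\<Sum>k\<in>S. cinner (e k) (\<psi> x) *s e k)" by (simp add: w_def)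
      moreover have "cinner u (\<psi> x) *s u = w"
      proof -
        have "cinner u (\<psi> x) = cinner u w"
          by (simp add: w_def cinner_diff_right ue_sum)
        also have "\<dots> = of_real (norm w)"
          by (cases "w = 0") (simp_all add: u_def cinner_scale_left cinner_self power2_eq_square)
        finally have "cinner u (\<psi> x) *s u = (of_real (norm w) * of_real (inverse (norm w))) *s w"
          by (simp only: u_def vector_smult_assoc)
        then show ?thesis by (cases "w = 0") simp_all
      qed
      ultimately show ?thesis unfolding jx[symmetric] split[unfolded jx[symmetric]] by simp
    qed
  qed
  ultimately show ?case by blast
qed

text \<open>The vector \<open>p\<close> is the orthogonal projection of \<open>v\<close>; the
  inequality is the nonnegativity of the squared length of \<open>v - p\<close>.\<close>

lemma bessel_inequality:
  assumes "finite S" "orthonormal_or_zero S e"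
  shows "(\<Sum>k\<in>S. (cmod (cinner (e k) v))\<^sup>2) \<le> (norm v)\<^sup>2"
proof -
  define p where "p = (\<Sum>k\<in>S. cinner (e k) v *s e k)"
  have sq: "cinner p y = (\<Sum>k\<in>S. of_real ((cmod (cinner (e k) v))\<^sup>2))"
    if "\<And>k. k \<in> S \<Longrightarrow> cinner (e k) y = cinner (e k) v" for y
    unfolding p_def cinner_sum_left cinner_scale_left
    by (rule sum.cong) (use that in \<open>auto simp only: complex_norm_square mult.commute\<close>)
  have "cinner p p = cinner p v"
    using sq[of p] sq[of v] cinner_expansion[OF assms] by (simp add: p_def)
  moreover from this have "cinner v p = cinner p p"
    using cnj_cinner[of p v] cnj_cinner[of p p] by metis
  ultimately have "cinner (v - p) (v - p) = cinner v v - cinner p v"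
    by (simp add: cinner_simps)
  then have "Re (cinner p v) \<le> (norm v)\<^sup>2"
    by (metis Re_complex_of_real cinner_self diff_ge_0_iff_ge minus_complex.sel(1) zero_le_power2)
  then show ?thesis using sq[of v] by simp
qed

lemma cinner_gram_column: "(dagger A ** B) $ i $ j = cinner (column i A) (column j B)"
  by (simp add: dagger_def matrix_matrix_mult_def cinner_def column_def)

text \<open>Let \<open>E\<close> take coefficients along Gram-Schmidt vectors of the columns of
  \<open>\<Psi>\<close>. It is a contraction by Bessel and preserves inner products of those
  columns, so the square matrix \<open>E ** \<Psi>\<close> has the same Gram matrix. A polar unitary
  then makes it positive semidefinite.\<close>

lemma contraction_psd_gram_root:
  fixes \<Psi> :: "complex ^ 'k ^ 'n"
  shows "\<exists>A :: complex ^ 'n ^ 'k. (\<forall>v. norm (A *v v) \<le> norm v) \<and> psd (A ** \<Psi>)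
    \<and> (A ** \<Psi>) ** (A ** \<Psi>) = dagger \<Psi> ** \<Psi>"
proof -
  obtain e :: "'k \<Rightarrow> complex ^ 'n" where e: "orthonormal_or_zero UNIV e"
    and span: "\<And>j. column j \<Psi> = (\<Sum>k\<in>UNIV. cinner (e k) (column j \<Psi>) *s e k)"
    using gram_schmidt[of "UNIV :: 'k set" "\<lambda>j. column j \<Psi>"] by auto
  define E :: "complex ^ 'n ^ 'k" where "E = (\<chi> k i. cnj (e k $ i))"
  have E: "(E *v v) $ k = cinner (e k) v" for v k
    by (simp add: E_def matrix_vector_mult_def cinner_def)
  obtain U where U: "unitary U" "psd (U ** (E ** \<Psi>))" using polar_decomposition by blast
  have contr: "norm ((U ** E) *v v) \<le> norm v" for v
  proof -
    have "(norm (E *v v))\<^sup>2 = (\<Sum>k\<in>UNIV. (cmod (cinner (e k) v))\<^sup>2)"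
      by (simp add: norm_vec_def L2_set_def sum_nonneg flip: E)
    also have "\<dots> \<le> (norm v)\<^sup>2" using bessel_inequality[OF _ e] by simp
    finally have "norm (E *v v) \<le> norm v" by (rule power2_le_imp_le) simp
    then show ?thesis using norm_unitary[OF U(1)] by (simp flip: matrix_vector_mul_assoc)
  qed
  have "dagger (E ** \<Psi>) ** (E ** \<Psi>) = dagger \<Psi> ** \<Psi>"
  proof -
    have col: "column j (E ** \<Psi>) = E *v column j \<Psi>" for j
      by (simp add: column_def matrix_matrix_mult_def matrix_vector_mult_def vec_eq_iff)
    have "cinner (column i \<Psi>) (column j \<Psi>) = cinner (E *v column i \<Psi>) (E *v column j \<Psi>)" for i j
    proof -
      have "cinner (column i \<Psi>) (column j \<Psi>) =
          cinner (\<Sum>k\<in>UNIV. cinner (e k) (column i \<Psi>) *s e k) (column j \<Psi>)"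
        by (rule arg_cong[where f = "\<lambda>x. cinner x _", OF span])
      also have "\<dots> = cinner (E *v column i \<Psi>) (E *v column j \<Psi>)"
        by (simp only: cinner_sum_left cinner_scale_left E[symmetric]) (simp only: cinner_def)
      finally show ?thesis .
    qed
    then show ?thesis by (simp add: vec_eq_iff cinner_gram_column col)
  qed
  moreover have "(U ** E ** \<Psi>) ** (U ** E ** \<Psi>) = dagger (E ** \<Psi>) ** (dagger U ** U) ** (E ** \<Psi>)"
  proof -
    \<comment> \<open>A positive semidefinite matrix is its own adjoint, so its square is a Gram
      matrix, from which the unitary cancels.\<close>
    have "(U ** E ** \<Psi>) ** (U ** E ** \<Psi>) = dagger (U ** (E ** \<Psi>)) ** (U ** (E ** \<Psi>))"
      using U(2) by (simp add: psd_def matrix_mul_assoc)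
    then show ?thesis by (simp add: dagger_mult matrix_mul_assoc)
  qed
  ultimately have "(U ** E ** \<Psi>) ** (U ** E ** \<Psi>) = dagger \<Psi> ** \<Psi>"
    using U(1) by (simp only: unitary_def matrix_mul_rid)
  then show ?thesis using contr U(2) by (intro exI[of _ "U ** E"]) (simp add: matrix_mul_assoc)
qed

section \<open>Lower bound on the success probability\<close>

text \<open>The rows of \<open>A\<close> serve as rank-one measurement vectors. Contractivity makes
  the defect 1 - A^* A positive semidefinite; adding it to one arbitrary outcome completes a POVM
  and cannot lower the success. The bijection \<open>f\<close> matches labels with rows.\<close>

lemma max_success_ge_contraction:
  fixes A :: "complex ^ 'n ^ 'k"
  assumes f: "bij_betw f H (UNIV :: 'k set)"
    and A: "\<And>v. norm (A *v v) \<le> norm v"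
    and \<rho>: "\<And>i. i \<in> H \<Longrightarrow> \<rho> i = ketbra (\<psi> i)"
  shows "(\<Sum>i\<in>H. (cmod ((A *v \<psi> i) $ f i))\<^sup>2) \<le> max_success \<rho> H"
proof -
  have fin: "finite H" using bij_betw_finite[OF f] by simp
  have "H \<noteq> {}" using f by (auto simp: bij_betw_def)
  then obtain h where h: "h \<in> H" by blast
  define m where "m i = (\<chi> j. cnj (A $ f i $ j))" for i
  have m: "cinner (m i) v = (A *v v) $ f i" for i v
    by (simp add: m_def cinner_def matrix_vector_mult_def)
  define R where "R = mat 1 - (\<Sum>i\<in>H. ketbra (m i))"
  define M where "M i = ketbra (m i) + (if i = h then R else 0)" for i
  have sum_mult: "(\<Sum>i\<in>H. ketbra (m i)) *v v = (\<Sum>i\<in>H. ketbra (m i) *v v)" for v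
    by (induction H rule: infinite_finite_induct) (simp_all add: matrix_vector_mult_add_rdistrib)
  have "cinner v (R *v v) = of_real ((norm v)\<^sup>2 - (norm (A *v v))\<^sup>2)" for v
  proof -
    have "(norm (A *v v))\<^sup>2 = (\<Sum>k\<in>UNIV. (cmod ((A *v v) $ k))\<^sup>2)"
      by (simp add: norm_vec_def L2_set_def sum_nonneg)
    also have "\<dots> = (\<Sum>i\<in>H. (cmod (cinner (m i) v))\<^sup>2)"
      unfolding m by (rule sum.reindex_bij_betw[OF f, symmetric])
    finally show ?thesis
      by (simp add: R_def matrix_vector_mult_diff_rdistrib sum_mult cinner_diff_right cinner_sum_right
          ketbra_form cinner_self)
  qed
  then have "psd R"
    unfolding psd_def using hermitian_if_form_real[of R] A by (simp add: power_mono)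
  then have "povm H M"
    using fin h by (auto simp: povm_def M_def psd_add psd_ketbra sum.distrib R_def)
  then have "success \<rho> H M \<le> max_success \<rho> H"
    using success_le_max_success[OF fin] by blast
  moreover have "(\<Sum>i\<in>H. (cmod ((A *v \<psi> i) $ f i))\<^sup>2) \<le> success \<rho> H M"
    unfolding success_def
  proof (rule sum_mono)
    fix i assume "i \<in> H"
    have "0 \<le> Re (cinner (\<psi> j) (R *v \<psi> j))" for j using \<open>psd R\<close> by (simp add: psd_def)
    then show "(cmod ((A *v \<psi> i) $ f i))\<^sup>2 \<le> Re (trace (\<rho> i ** M i))"
      by (simp add: \<rho>[OF \<open>i \<in> H\<close>] trace_ketbra_mult M_def matrix_vector_mult_add_rdistrib
          cinner_add_right ketbra_form m)
  qed
  ultimately show ?thesis by linarith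
qed

section \<open>Eigenvalues of 3 x 3 matrices\<close>

text \<open>The sum of the principal 2 x 2 minors, that is, the second elementary symmetric function
  of the eigenvalues.\<close>

definition minor_sum3 :: "'a :: comm_ring_1 ^ 3 ^ 3 \<Rightarrow> 'a"
  where "minor_sum3 X = (X $ 1 $ 1 * X $ 2 $ 2 - X $ 1 $ 2 * X $ 2 $ 1)
    + (X $ 1 $ 1 * X $ 3 $ 3 - X $ 1 $ 3 * X $ 3 $ 1)
    + (X $ 2 $ 2 * X $ 3 $ 3 - X $ 2 $ 3 * X $ 3 $ 2)"

lemma trace_3: "trace (X :: 'a :: comm_ring_1 ^ 3 ^ 3) = X $ 1 $ 1 + X $ 2 $ 2 + X $ 3 $ 3"
  by (simp add: trace_def sum_3)

lemma trace_square3: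
  "trace (X ** X) = (trace X)\<^sup>2 - 2 * minor_sum3 (X :: 'a :: comm_ring_1 ^ 3 ^ 3)"
  unfolding trace_3 minor_sum3_def matrix_matrix_mult_def vec_lambda_beta sum_3
  by (simp add: algebra_simps power2_eq_square)

text \<open>Together with the trace identity above, this transfers symmetric functions of the
  eigenvalues from a square root to the Gram matrix without diagonalization.\<close>

lemma minor_sum3_square:
  "minor_sum3 (X ** X) = (minor_sum3 X)\<^sup>2 - 2 * trace X * det (X :: 'a :: comm_ring_1 ^ 3 ^ 3)"
  unfolding trace_3 minor_sum3_def matrix_matrix_mult_def vec_lambda_beta sum_3 det_3
  by (simp add: algebra_simps power2_eq_square)

lemma complex_cubic_splits:
  fixes p q d :: complex
  shows "\<exists>a b c. p = a + b + c \<and> q = a * b + b * c + c * a \<and> d = a * b * c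
    \<and> (\<forall>z. z ^ 3 - p * z\<^sup>2 + q * z - d = (z - a) * (z - b) * (z - c))"
proof -
  have root_exists: "\<exists>z. poly f z = 0" if "degree f \<noteq> 0" for f :: "complex poly"
    using that fundamental_theorem_of_algebra[of f] by (simp add: constant_degree)
  obtain a where a: "poly [: - d, q, - p, 1 :] a = 0"
    using root_exists[of "[: - d, q, - p, 1 :]"] by auto
  \<comment> \<open>This quadratic is the quotient of the cubic by z - a.\<close>
  obtain b where b: "poly [: a\<^sup>2 - p * a + q, a - p, 1 :] b = 0"
    using root_exists[of "[: a\<^sup>2 - p * a + q, a - p, 1 :]"] by auto
  define c where "c = p - a - b"
  have p: "p = a + b + c" by (simp add: c_def)
  have "q + (a\<^sup>2 - p * a + b * (a - p + b)) = 0"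
    using b by (simp add: algebra_simps)
  then have "q = - (a\<^sup>2 - p * a + b * (a - p + b))" by (simp only: eq_neg_iff_add_eq_0)
  then have q: "q = a * b + b * c + c * a" by (simp add: p power2_eq_square algebra_simps)
  have "d = a * (q + a * (a - p))" using a by simp
  then have d: "d = a * b * c" by (simp add: p q algebra_simps)
  have "z ^ 3 - p * z\<^sup>2 + q * z - d = (z - a) * (z - b) * (z - c)" for z
    by (simp add: p q d power2_eq_square power3_eq_cube algebra_simps)
  then show ?thesis using p q d by blast
qed

text \<open>Each root of the characteristic polynomial has an eigenvector, and the form of
  \<open>X\<close> there is the root times a positive number; hence all three roots are real and
  nonnegative.\<close>

lemma psd3_eigenvalues:
  fixes X :: "complex ^ 3 ^ 3"
  assumes X: "psd X"
  obtains a b c :: real where "0 \<le> a" "0 \<le> b" "0 \<le> c" "trace X = of_real (a + b + c)"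
    "minor_sum3 X = of_real (a * b + b * c + c * a)" "det X = of_real (a * b * c)"
proof -
  have real_root: "z = of_real (Re z) \<and> 0 \<le> Re z"
    if z: "z ^ 3 - trace X * z\<^sup>2 + minor_sum3 X * z - det X = 0" for z
  proof -
    have "det (X - mat z) = - (z ^ 3 - trace X * z\<^sup>2 + minor_sum3 X * z - det X)"
      by (simp add: det_3 trace_3 minor_sum3_def mat_def algebra_simps power2_eq_square power3_eq_cube)
    then have "\<not> invertible (X - mat z)" using z by (simp add: invertible_det_nz)
    then obtain v where v: "v \<noteq> 0" "(X - mat z) *v v = 0"
      unfolding invertible_left_inverse matrix_left_invertible_ker by auto
    have "mat z *v v = z *s v"
      by (simp add: vec_eq_iff matrix_vector_mult_def mat_def if_distrib[of "\<lambda>x. x * _"] cong: if_cong)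
    then have "X *v v = z *s v" using v(2) by (simp add: matrix_vector_mult_diff_rdistrib)
    then have eq: "cinner v (X *v v) = z * of_real ((norm v)\<^sup>2)"
      by (simp only: cinner_scale_right cinner_self)
    have "cnj (cinner v (X *v v)) = cinner v (X *v v)"
      using X cinner_dagger[of v X v] by (simp add: psd_def cnj_cinner)
    then have "cnj z = z" using v(1) by (simp add: eq)
    moreover have "Re (cinner v (X *v v)) = Re z * (norm v)\<^sup>2"
      by (simp add: eq del: of_real_power)
    then have "0 \<le> Re z * (norm v)\<^sup>2" using X unfolding psd_def by metis
    ultimately show ?thesis using v(1)
      by (auto simp: zero_le_mult_iff complex_eq_iff)
  qed
  obtain a b c where p: "trace X = a + b + c" and q: "minor_sum3 X = a * b + b * c + c * a"
    and d: "det X = a * b * c"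
    and fac: "\<And>z. z ^ 3 - trace X * z\<^sup>2 + minor_sum3 X * z - det X = (z - a) * (z - b) * (z - c)"
    using complex_cubic_splits by metis
  have "z = of_real (Re z) \<and> 0 \<le> Re z" if "z \<in> {a, b, c}" for z
    using that by (intro real_root) (auto simp: fac)
  then have r: "a = of_real (Re a)" "b = of_real (Re b)" "c = of_real (Re c)"
    "0 \<le> Re a" "0 \<le> Re b" "0 \<le> Re c" by auto
  show ?thesis
  proof (rule that[of "Re a" "Re b" "Re c"])
    show "trace X = of_real (Re a + Re b + Re c)" using r(1-3) p by (metis of_real_add)
    show "minor_sum3 X = of_real (Re a * Re b + Re b * Re c + Re c * Re a)"
      using r(1-3) q by (metis of_real_add of_real_mult)
    show "det X = of_real (Re a * Re b * Re c)" using r(1-3) d by (metis of_real_mult)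
  qed (use r in auto)
qed

section \<open>The inequality for the eigenvalues\<close>

text \<open>For x >= y >= z the first two terms combine to (x - y) times a difference that is
  nonnegative by monotonicity, and the third is a product of nonnegative factors. Symmetry covers
  the other orders.\<close>

lemma schur_degree_four:
  fixes x y z :: real
  assumes "0 \<le> x" "0 \<le> y" "0 \<le> z"
  shows "0 \<le> x\<^sup>2 * (x - y) * (x - z) + y\<^sup>2 * (y - x) * (y - z) + z\<^sup>2 * (z - x) * (z - y)"
proof -
  have ordered: "0 \<le> x\<^sup>2 * (x - y) * (x - z) + y\<^sup>2 * (y - x) * (y - z) + z\<^sup>2 * (z - x) * (z - y)"
    if "z \<le> y" "y \<le> x" "0 \<le> z" for x y z :: real
  proof -
    have "y\<^sup>2 * (y - z) \<le> x\<^sup>2 * (x - z)" using that by (intro mult_mono power_mono) auto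
    then have "0 \<le> (x - y) * (x\<^sup>2 * (x - z) - y\<^sup>2 * (y - z)) + z\<^sup>2 * ((x - z) * (y - z))"
      using that by simp
    then show ?thesis by (simp add: algebra_simps)
  qed
  show ?thesis
    using ordered[of x y z] ordered[of x z y] ordered[of y x z] ordered[of y z x] ordered[of z x y]
      ordered[of z y x] assms
    by (smt (verit) mult.commute mult.left_commute)
qed

text \<open>With \<open>t\<close> the Euclidean norm of the \<open>s\<close> values and
  \<open>q\<close> the second symmetric function of \<open>a\<close>, \<open>b\<close>,
  \<open>c\<close>, Cauchy-Schwarz gives \<delta> <= sqrt 3 t - 1 - 2 q / 3. For t <= 3/2 the bound
  q >= t suffices; beyond that Schur's inequality forces \<open>q\<close> to be larger. The extremal
  point is t = q = 3/2.\<close>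

lemma sum_minus_trace_bound:
  fixes a b c s1 s2 s3 :: real
  assumes nonneg: "0 \<le> a" "0 \<le> b" "0 \<le> c"
    and sq: "a\<^sup>2 + b\<^sup>2 + c\<^sup>2 = 3"
    and s: "s1\<^sup>2 + s2\<^sup>2 + s3\<^sup>2 = (a * b)\<^sup>2 + (b * c)\<^sup>2 + (c * a)\<^sup>2"
  defines "\<delta> \<equiv> s1 + s2 + s3 - (a + b + c)\<^sup>2 / 3"
  shows "\<delta> \<le> 3 * sqrt 3 / 2 - 2"
    and "\<delta> = 3 * sqrt 3 / 2 - 2 \<Longrightarrow>
      a * b * c = 0 \<and> s1\<^sup>2 = 3 / 4 \<and> s2\<^sup>2 = 3 / 4 \<and> s3\<^sup>2 = 3 / 4"
proof -
  define p q r t where "p = a + b + c" and "q = a * b + b * c + c * a" and "r = a * b * c"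
    and "t = sqrt (s1\<^sup>2 + s2\<^sup>2 + s3\<^sup>2)"
  have t: "0 \<le> t" "t\<^sup>2 = s1\<^sup>2 + s2\<^sup>2 + s3\<^sup>2" by (simp_all add: t_def)
  have pq: "p\<^sup>2 = 3 + 2 * q" using sq by (simp add: p_def q_def power2_eq_square algebra_simps)
  have qt: "q\<^sup>2 = t\<^sup>2 + 2 * p * r"
    unfolding t(2) s by (simp add: p_def q_def r_def power2_eq_square algebra_simps)
  have pos: "0 \<le> q" "0 \<le> p" "0 \<le> r" using nonneg by (simp_all add: p_def q_def r_def)
  have tq: "t \<le> q" using pos t(1) qt by (auto intro: power2_le_imp_le[OF _ pos(1)])
  have "0 \<le> (a - b)\<^sup>2 + (b - c)\<^sup>2 + (c - a)\<^sup>2" by simp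
  then have q3: "q \<le> 3" using sq by (simp add: q_def power2_eq_square algebra_simps)
  \<comment> \<open>Cauchy-Schwarz with its defect kept explicit, so that equality later forces the
    three values to agree.\<close>
  have dev: "(s1 + s2 + s3)\<^sup>2 + ((s1 - s2)\<^sup>2 + (s2 - s3)\<^sup>2 + (s1 - s3)\<^sup>2) = (sqrt 3 * t)\<^sup>2"
    by (simp add: power_mult_distrib t(2)) (simp add: power2_eq_square algebra_simps)
  have sum_le: "s1 + s2 + s3 \<le> sqrt 3 * t"
  proof (rule power2_le_imp_le)
    have "0 \<le> (s1 - s2)\<^sup>2 + (s2 - s3)\<^sup>2 + (s1 - s3)\<^sup>2" by simp
    then show "(s1 + s2 + s3)\<^sup>2 \<le> (sqrt 3 * t)\<^sup>2" using dev by linarith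
  qed (use t in simp)
  have \<delta>: "\<delta> = s1 + s2 + s3 - 1 - 2 / 3 * q"
    using pq by (simp add: \<delta>_def p_def[symmetric] add_divide_distrib)
  \<comment> \<open>Eliminating \<open>p\<close> and \<open>r\<close> from Schur's inequality leaves
    3 (t^2 - 9/4) <= (q - 3/2)^2. The goal follows once q - 3/2 exceeds (3 sqrt 3 / 2) (t -
    3/2).\<close>
  have large: "\<delta> < 3 * sqrt 3 / 2 - 2" if "3 / 2 < t"
  proof -
    have "0 \<le> p ^ 4 - 5 * p\<^sup>2 * q + 4 * q\<^sup>2 + 6 * p * r"
      using schur_degree_four[OF nonneg]
      by (simp add: p_def q_def r_def power2_eq_square power4_eq_xxxx algebra_simps)
    moreover have "p ^ 4 = (3 + 2 * q)\<^sup>2" using pq by (simp add: power4_eq_xxxx power2_eq_square)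
    moreover have "p\<^sup>2 * q = (3 + 2 * q) * q" using pq by simp
    ultimately have "3 * (t\<^sup>2 - 9 / 4) \<le> (q - 3 / 2)\<^sup>2"
      using qt by (simp add: power2_eq_square algebra_simps)
    \<comment> \<open>After cancelling t - 3/2 this amounts to t < 39/10, which t <= q <= 3
      ensures.\<close>
    moreover have "27 / 4 * (t - 3 / 2) * (t - 3 / 2) < 3 * (t + 3 / 2) * (t - 3 / 2)"
      using that tq q3 by (intro mult_strict_right_mono) auto
    moreover have "(3 * sqrt 3 / 2 * (t - 3 / 2))\<^sup>2 = 27 / 4 * (t - 3 / 2) * (t - 3 / 2)"
      by (simp only: power_mult_distrib power_divide) (simp add: power2_eq_square)
    moreover have "3 * (t + 3 / 2) * (t - 3 / 2) = 3 * (t\<^sup>2 - 9 / 4)"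
      by (simp add: power2_eq_square field_simps)
    ultimately have "(3 * sqrt 3 / 2 * (t - 3 / 2))\<^sup>2 < (q - 3 / 2)\<^sup>2"
      by linarith
    then have "3 * sqrt 3 / 2 * (t - 3 / 2) < q - 3 / 2"
      by (rule power2_less_imp_less) (use that tq in simp)
    moreover have "3 * sqrt 3 / 2 * (t - 3 / 2) = 3 / 2 * (sqrt 3 * t) - 9 / 4 * sqrt 3"
      by (simp add: field_simps)
    ultimately show ?thesis using sum_le unfolding \<delta> by linarith
  qed
  have slope: "0 < sqrt 3 - 2 / 3"
  proof -
    have "1 \<le> sqrt 3" by simp
    then show ?thesis by linarith
  qed
  \<comment> \<open>Replacing \<open>q\<close> by \<open>t\<close> leaves an increasing affine
    function of \<open>t\<close> whose value at 3/2 is the desired bound.\<close>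
  have small: "\<delta> \<le> 3 * sqrt 3 / 2 - 2 - (sqrt 3 - 2 / 3) * (3 / 2 - t)"
  proof -
    have "(sqrt 3 - 2 / 3) * (3 / 2 - t) = 3 / 2 * sqrt 3 - sqrt 3 * t - 1 + 2 / 3 * t"
      by (simp add: field_simps)
    then show ?thesis using sum_le tq unfolding \<delta> by linarith
  qed
  show "\<delta> \<le> 3 * sqrt 3 / 2 - 2"
  proof (cases "t \<le> 3 / 2")
    case True
    then have "0 \<le> (sqrt 3 - 2 / 3) * (3 / 2 - t)" using slope by simp
    then show ?thesis using small by linarith
  qed (use large in auto)
  assume eq: "\<delta> = 3 * sqrt 3 / 2 - 2"
  have t32: "t = 3 / 2"
  proof (rule ccontr)
    assume "t \<noteq> 3 / 2"
    with large eq have "t < 3 / 2" by force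
    then have "0 < (sqrt 3 - 2 / 3) * (3 / 2 - t)" using slope by simp
    then show False using small eq by linarith
  qed
  \<comment> \<open>Both estimates used for \<delta> must be tight: the first yields p r = 0, the
    second a vanishing Cauchy-Schwarz defect.\<close>
  have "q = t" "s1 + s2 + s3 = sqrt 3 * t"
    using sum_le tq eq unfolding \<delta> t32 by linarith+
  then have "p * r = 0" and diffs: "(s1 - s2)\<^sup>2 + (s2 - s3)\<^sup>2 + (s1 - s3)\<^sup>2 = 0"
    using qt dev by auto
  moreover have "p \<noteq> 0" using pq pos by auto
  ultimately have "r = 0" by simp
  have "s1 = s2" "s2 = s3" using diffs by (smt (verit) zero_le_power2 zero_eq_power2)+
  then show "a * b * c = 0 \<and> s1\<^sup>2 = 3 / 4 \<and> s2\<^sup>2 = 3 / 4 \<and> s3\<^sup>2 = 3 / 4"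
    using \<open>r = 0\<close> t(2) by (simp add: r_def t32 power_divide)
qed

section \<open>The case of equality\<close>

text \<open>Phases can be chosen so that all mutual inner products equal -1/2. The three vectors
  then sum to zero, span a plane, and have the same Gram matrix as suitable trine vectors.\<close>

lemma trine_if_gram:
  fixes \<psi> :: "nat \<Rightarrow> complex ^ 'n"
  assumes unit: "\<And>i. i \<in> {1, 2, 3} \<Longrightarrow> norm (\<psi> i) = 1"
    and half: "cmod (cinner (\<psi> 1) (\<psi> 2)) = 1 / 2" "cmod (cinner (\<psi> 1) (\<psi> 3)) = 1 / 2"
    and triple: "cinner (\<psi> 1) (\<psi> 2) * cinner (\<psi> 2) (\<psi> 3) * cinner (\<psi> 3) (\<psi> 1) = - 1 / 8"
  shows "\<exists>V :: complex ^ 2 ^ 'n. isometry V \<and>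
    (\<forall>i\<in>{1, 2, 3}. ketbra (\<psi> i) = V ** trine i ** dagger V)"
proof -
  note [simp del] = One_nat_def
  define a b c where "a = cinner (\<psi> 1) (\<psi> 2)" and "b = cinner (\<psi> 1) (\<psi> 3)"
    and "c = cinner (\<psi> 2) (\<psi> 3)"
  have ab: "cmod a = 1 / 2" "cmod b = 1 / 2" using half by (simp_all only: a_def b_def)
  then have ne: "a \<noteq> 0" "b \<noteq> 0" by auto
  have quarter: "z * cnj z = 1 / 4" if "cmod z = 1 / 2" for z
    by (simp only: complex_norm_square[symmetric] that) (simp add: power2_eq_square)
  have aa: "a * cnj a = 1 / 4" and bb: "b * cnj b = 1 / 4"
    using ab by (simp_all only: quarter)
  \<comment> \<open>Since |a| = |b| = 1/2, these factors are phases; they turn the inner products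
    with \<open>\<psi> 1\<close> into -1/2. The triple product, which is invariant under phases,
    then determines the remaining one.\<close>
  define x y where "x = (- 1 / (2 * a)) *s \<psi> 2" and "y = (- 1 / (2 * b)) *s \<psi> 3"
  have ph: "cmod (- 1 / (2 * a)) = 1" "cmod (- 1 / (2 * b)) = 1"
    by (simp_all add: ab norm_divide norm_mult)
  have self: "cinner (\<psi> 1) (\<psi> 1) = 1" "cinner x x = 1" "cinner y y = 1"
    using unit ph by (simp_all add: cinner_self x_def y_def norm_vector_scale)
  have ux: "cinner (\<psi> 1) x = - 1 / 2" and uy: "cinner (\<psi> 1) y = - 1 / 2"
    unfolding x_def y_def cinner_scale_right a_def[symmetric] b_def[symmetric] using ne by simp_all
  have xu: "cinner x (\<psi> 1) = - 1 / 2" and yu: "cinner y (\<psi> 1) = - 1 / 2"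
    unfolding cnj_cinner[of "\<psi> 1", symmetric] ux uy by simp_all
  have xy: "cinner x y = - 1 / 2"
  proof -
    have "cinner x y = c / (4 * (cnj a * b))"
      unfolding x_def y_def cinner_scale_left cinner_scale_right c_def[symmetric] by simp
    also have "\<dots> = - 1 / 2"
    proof -
      have "a * c * cnj b = - 1 / 8" using triple by (simp only: a_def b_def c_def cnj_cinner)
      then have "(a * cnj a) * (b * cnj b) * c = - 1 / 8 * (cnj a * b)"
        by (metis (no_types, opaque_lifting) mult.assoc mult.commute)
      then have "c = - 2 * (cnj a * b)" by (simp add: aa bb)
      then show ?thesis using ne by simp
    qed
    finally show ?thesis .
  qed
  have yx: "cinner y x = - 1 / 2" unfolding cnj_cinner[of x y, symmetric] xy by simp
  have "cinner (\<psi> 1 + x + y) (\<psi> 1 + x + y) = 0"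
    by (simp add: cinner_simps self ux uy xu yu xy yx)
  then have "\<psi> 1 + x + y = 0" by (simp only: cinner_eq_zero_iff)
  then have y: "y = - \<psi> 1 - x" by (metis add.commute add_eq_0_iff diff_conv_add_uminus minus_add_distrib)
  \<comment> \<open>\<open>v1\<close> and \<open>v2\<close> are the discrete Fourier transform of \<open>\<psi> 1, x, y\<close>, with \<open>y\<close> eliminated through \<open>\<psi> 1 + x + y = 0\<close>.\<close>
  define \<alpha> \<beta> :: complex where "\<alpha> = Complex (sqrt 2 / 2) (- sqrt 6 / 6)" and "\<beta> = Complex 0 (- sqrt 6 / 3)"
  define v1 v2 where "v1 = \<alpha> *s \<psi> 1 + \<beta> *s x" and "v2 = cnj \<alpha> *s \<psi> 1 + cnj \<beta> *s x"
  have s6: "sqrt 6 = sqrt 2 * sqrt 3" by (simp add: real_sqrt_mult[symmetric])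
  have orth: "cinner v1 v1 = 1" "cinner v2 v2 = 1" "cinner v1 v2 = 0" "cinner v2 v1 = 0"
    by (simp_all add: v1_def v2_def cinner_simps self ux xu \<alpha>_def \<beta>_def complex_eq_iff s6 algebra_simps)
  define V :: "complex ^ 2 ^ 'n" where "V = (\<chi> i j. if j = 1 then v1 $ i else v2 $ i)"
  have col: "column 1 V = v1" "column 2 V = v2" by (simp_all add: V_def column_def vec_eq_iff)
  have iso: "isometry V"
    by (simp add: isometry_def vec_eq_iff cinner_gram_column forall_2 col orth mat_def)
  \<comment> \<open>The vectors are (w, cnj w) / sqrt 2 for the cube roots of unity w. With these
    phases they too sum to zero and have mutual inner products -1/2, so \<open>V\<close> can send
    them exactly to \<open>\<psi> 1\<close>, \<open>x\<close>, \<open>y\<close>.\<close>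
  define \<tau> :: "nat \<Rightarrow> complex ^ 2" where "\<tau> i =
    (if i = 1 then vector [of_real (1 / sqrt 2), of_real (1 / sqrt 2)]
     else if i = 2 then vector [Complex (- 1 / 2) (sqrt 3 / 2) / sqrt 2, Complex (- 1 / 2) (- sqrt 3 / 2) / sqrt 2]
     else vector [Complex (- 1 / 2) (- sqrt 3 / 2) / sqrt 2, Complex (- 1 / 2) (sqrt 3 / 2) / sqrt 2])" for i
  have trine: "trine i = ketbra (\<tau> i)" if "i \<in> {1, 2, 3}" for i
    using that
    by (auto simp: trine_def bloch_state_def trine_bloch_def ketbra_def \<tau>_def vec_eq_iff forall_2
        pauli_x_def pauli_y_def pauli_z_def mat_def vector_3 complex_eq_iff field_simps)
  have V\<tau>: "V *v t = t $ 1 *s v1 + t $ 2 *s v2" for t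
    by (simp add: V_def matrix_vector_mult_def vec_eq_iff sum_2 mult.commute)
  have V1: "V *v \<tau> 1 = \<psi> 1" and V2: "V *v \<tau> 2 = x"
    unfolding V\<tau> by (simp_all add: \<tau>_def v1_def v2_def vec_eq_iff \<alpha>_def \<beta>_def complex_eq_iff s6 field_simps)
  have V3: "V *v \<tau> 3 = y"
    unfolding V\<tau> y by (simp add: \<tau>_def v1_def v2_def vec_eq_iff \<alpha>_def \<beta>_def complex_eq_iff s6 field_simps)
  have "ketbra (\<psi> i) = V ** trine i ** dagger V" if "i \<in> {1, 2, 3}" for i
    using that V1 V2 V3 ketbra_phase[OF ph(1), of "\<psi> 2"] ketbra_phase[OF ph(2), of "\<psi> 3"]
    by (auto simp: trine conjugate_ketbra x_def y_def)
  then show ?thesis using iso by blast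
qed

theorem theoremA1:
  fixes \<rho> :: "nat \<Rightarrow> complex ^ 'n ^ 'n" and \<beta> :: real
  assumes "\<forall>i\<in>{1, 2, 3}. pure_state (\<rho> i)"
    and "\<beta> = min_error \<rho> {1, 2, 3} - min_error \<rho> {1, 2} - min_error \<rho> {1, 3} - min_error \<rho> {2, 3}"
  shows "\<beta> \<le> 3 * sqrt 3 / 2 - 2 \<and>
    (\<beta> = 3 * sqrt 3 / 2 - 2 \<longrightarrow>
      (\<exists>(V :: complex ^ 2 ^ 'n) (U :: complex ^ 'n ^ 'n) \<pi>.
        isometry V \<and> unitary U \<and> \<pi> permutes {1, 2, 3} \<and>
        (\<forall>i\<in>{1, 2, 3}. \<rho> (\<pi> i) = U ** (V ** trine i ** dagger V) ** dagger U)))"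
proof -
  note [simp del] = One_nat_def
  have "\<exists>\<psi>. \<forall>i\<in>{1, 2, 3}. norm (\<psi> i) = 1 \<and> \<rho> i = ketbra (\<psi> i)"
    using assms(1) unfolding pure_state_def by (rule bchoice)
  then obtain \<psi> where \<psi>_all: "\<forall>i\<in>{1, 2, 3}. norm (\<psi> i) = 1 \<and> \<rho> i = ketbra (\<psi> i)" ..
  have \<psi>: "norm (\<psi> i) = 1" "\<rho> i = ketbra (\<psi> i)" if "i \<in> {1, 2, 3}" for i
    using bspec[OF \<psi>_all that] by blast+
  define s where "s i j = sqrt (1 - (cmod (cinner (\<psi> i) (\<psi> j)))\<^sup>2)" for i j
  have pair: "max_success \<rho> {i, j} \<le> 1 + s i j" if "i \<noteq> j" "i \<in> {1, 2, 3}" "j \<in> {1, 2, 3}" for i j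
    unfolding s_def
    by (rule max_success_pair_le[OF that(1) \<psi>(2)[OF that(2)] \<psi>(2)[OF that(3)]
          \<psi>(1)[OF that(2)] \<psi>(1)[OF that(3)]])
  have s2: "(s i j)\<^sup>2 = 1 - (cmod (cinner (\<psi> i) (\<psi> j)))\<^sup>2" if "i \<noteq> j" "i \<in> {1, 2, 3}" "j \<in> {1, 2, 3}" for i j
  proof -
    \<comment> \<open>Cauchy-Schwarz, obtained as Bessel's inequality for a single unit
      vector.\<close>
    have "(cmod (cinner (\<psi> i) (\<psi> j)))\<^sup>2 \<le> 1"
      using bessel_inequality[of "{i}" \<psi> "\<psi> j"] \<psi>(1)[OF that(2)] \<psi>(1)[OF that(3)]
      by (simp add: orthonormal_or_zero_def)
    then show ?thesis by (simp add: s_def)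
  qed
  define f :: "nat \<Rightarrow> 3" where "f i = (if i = 1 then 1 else if i = 2 then 2 else 3)" for i
  have f: "f 1 = 1" "f 2 = 2" "f 3 = 3" by (simp_all add: f_def)
  have bij: "bij_betw f {1, 2, 3} UNIV"
  proof (rule bij_betw_imageI)
    show image: "f ` {1, 2, 3} = UNIV" unfolding image_insert image_empty f UNIV_3 ..
    have "card (f ` {1, 2, 3}) = card {1 :: nat, 2, 3}" unfolding image by simp
    then show "inj_on f {1, 2, 3}" by (rule eq_card_imp_inj_on[rotated]) simp
  qed
  define \<Psi> :: "complex ^ 3 ^ 'n" where "\<Psi> = (\<chi> k j. (vector [\<psi> 1, \<psi> 2, \<psi> 3] :: (complex ^ 'n) ^ 3) $ j $ k)"
  have col: "column 1 \<Psi> = \<psi> 1" "column 2 \<Psi> = \<psi> 2" "column 3 \<Psi> = \<psi> 3"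
    by (simp_all add: column_def \<Psi>_def vec_eq_iff)
  obtain A :: "complex ^ 'n ^ 3" where A: "\<And>v. norm (A *v v) \<le> norm v" "psd (A ** \<Psi>)"
    "(A ** \<Psi>) ** (A ** \<Psi>) = dagger \<Psi> ** \<Psi>"
    using contraction_psd_gram_root[of \<Psi>] by blast
  define X where "X = A ** \<Psi>"
  define G where "G = dagger \<Psi> ** \<Psi>"
  have XX: "X ** X = G" using A(3) by (simp add: X_def G_def)
  have AX: "(A *v column j \<Psi>) $ i = X $ i $ j" for i j
    by (simp add: X_def matrix_vector_mult_def matrix_matrix_mult_def column_def)
  have G: "G $ i $ j = cinner (column i \<Psi>) (column j \<Psi>)" for i j
    by (simp add: G_def cinner_gram_column)
  obtain a b c :: real where abc: "0 \<le> a" "0 \<le> b" "0 \<le> c" "trace X = of_real (a + b + c)"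
    "minor_sum3 X = of_real (a * b + b * c + c * a)" "det X = of_real (a * b * c)"
    using psd3_eigenvalues A(2) unfolding X_def by metis
  have D: "(a + b + c)\<^sup>2 / 3 \<le> max_success \<rho> {1, 2, 3}"
  proof -
    have "(\<Sum>i\<in>{1, 2, 3}. (cmod ((A *v \<psi> i) $ f i))\<^sup>2) \<le> max_success \<rho> {1, 2, 3}"
      using max_success_ge_contraction[OF bij A(1) \<psi>(2)] .
    then have "(cmod (X $ 1 $ 1))\<^sup>2 + (cmod (X $ 2 $ 2))\<^sup>2 + (cmod (X $ 3 $ 3))\<^sup>2
        \<le> max_success \<rho> {1, 2, 3}"
      by (simp add: f AX[symmetric] col)
    moreover have "(Re (X $ i $ i))\<^sup>2 \<le> (cmod (X $ i $ i))\<^sup>2" for i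
      by (simp add: cmod_power2)
    moreover have "a + b + c = Re (X $ 1 $ 1) + Re (X $ 2 $ 2) + Re (X $ 3 $ 3)"
      using arg_cong[OF abc(4), of Re] by (simp add: trace_3)
    \<comment> \<open>This passes from the diagonal of \<open>X\<close>, which depends on the basis,
      to its trace, which depends only on the eigenvalues.\<close>
    moreover have "(x + y + z)\<^sup>2 / 3 \<le> x\<^sup>2 + y\<^sup>2 + z\<^sup>2" for x y z :: real
    proof -
      have "0 \<le> (x - y)\<^sup>2 + (y - z)\<^sup>2 + (x - z)\<^sup>2" by simp
      then show ?thesis by (simp add: power2_eq_square algebra_simps)
    qed
    ultimately show ?thesis by (smt (verit))
  qed
  have Gjj: "G $ 1 $ 1 = 1" "G $ 2 $ 2 = 1" "G $ 3 $ 3 = 1"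
    using \<psi>(1) by (simp_all add: G col cinner_self)
  have G12: "G $ 1 $ 2 * G $ 2 $ 1 = of_real ((cmod (cinner (\<psi> 1) (\<psi> 2)))\<^sup>2)"
    and G13: "G $ 1 $ 3 * G $ 3 $ 1 = of_real ((cmod (cinner (\<psi> 1) (\<psi> 3)))\<^sup>2)"
    and G23: "G $ 2 $ 3 * G $ 3 $ 2 = of_real ((cmod (cinner (\<psi> 2) (\<psi> 3)))\<^sup>2)"
    by (simp_all only: G col complex_norm_square cnj_cinner)
  have sq: "a\<^sup>2 + b\<^sup>2 + c\<^sup>2 = 3"
  proof -
    have "trace G = of_real ((a + b + c)\<^sup>2 - 2 * (a * b + b * c + c * a))"
      unfolding XX[symmetric] trace_square3 abc by simp
    moreover have "trace G = of_real 3" by (simp add: trace_3 Gjj)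
    ultimately have "(a + b + c)\<^sup>2 - 2 * (a * b + b * c + c * a) = 3" by (simp only: of_real_eq_iff)
    then show ?thesis by (simp add: power2_eq_square algebra_simps)
  qed
  have ssum: "(s 1 2)\<^sup>2 + (s 1 3)\<^sup>2 + (s 2 3)\<^sup>2 = (a * b)\<^sup>2 + (b * c)\<^sup>2 + (c * a)\<^sup>2"
  proof -
    have "minor_sum3 G = of_real ((a * b + b * c + c * a)\<^sup>2 - 2 * (a + b + c) * (a * b * c))"
      unfolding XX[symmetric] minor_sum3_square abc by simp
    moreover have "minor_sum3 G = of_real ((s 1 2)\<^sup>2 + (s 1 3)\<^sup>2 + (s 2 3)\<^sup>2)"
      by (simp add: minor_sum3_def Gjj G12 G13 G23 s2)
    ultimately have "(s 1 2)\<^sup>2 + (s 1 3)\<^sup>2 + (s 2 3)\<^sup>2 =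
        (a * b + b * c + c * a)\<^sup>2 - 2 * (a + b + c) * (a * b * c)"
      by (simp only: of_real_eq_iff)
    then show ?thesis by (simp add: power2_eq_square algebra_simps)
  qed
  note bound = sum_minus_trace_bound[OF abc(1-3) sq ssum]
  \<comment> \<open>The cardinalities contribute 3 - 6 = -3, cancelling the three ones in the pair
    bounds.\<close>
  have \<beta>: "\<beta> \<le> s 1 2 + s 1 3 + s 2 3 - (a + b + c)\<^sup>2 / 3"
    using assms(2) pair[of 1 2] pair[of 1 3] pair[of 2 3] D by (simp add: min_error_def)
  have "\<exists>(V :: complex ^ 2 ^ 'n) (U :: complex ^ 'n ^ 'n) \<pi>.
        isometry V \<and> unitary U \<and> \<pi> permutes {1, 2, 3} \<and>
        (\<forall>i\<in>{1, 2, 3}. \<rho> (\<pi> i) = U ** (V ** trine i ** dagger V) ** dagger U)"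
    if eq: "\<beta> = 3 * sqrt 3 / 2 - 2"
  proof -
    have r: "a * b * c = 0" and s34: "(s 1 2)\<^sup>2 = 3 / 4" "(s 1 3)\<^sup>2 = 3 / 4" "(s 2 3)\<^sup>2 = 3 / 4"
      using bound \<beta> eq by auto
    have quarter: "(cmod (cinner (\<psi> 1) (\<psi> 2)))\<^sup>2 = 1 / 4" "(cmod (cinner (\<psi> 1) (\<psi> 3)))\<^sup>2 = 1 / 4"
      "(cmod (cinner (\<psi> 2) (\<psi> 3)))\<^sup>2 = 1 / 4"
      using s34 by (simp_all add: s2)
    have half: "x = 1 / 2" if "x\<^sup>2 = 1 / 4" "0 \<le> x" for x :: real
      using that power2_eq_iff_nonneg[of x "1 / 2"] by (simp add: power_divide)
    define z where "z = cinner (\<psi> 1) (\<psi> 2) * cinner (\<psi> 2) (\<psi> 3) * cinner (\<psi> 3) (\<psi> 1)"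
    \<comment> \<open>The determinant fixes Re z = -1/8, while |z| = 1/8 by the moduli; together
      they leave no imaginary part.\<close>
    have "det G = 0" unfolding XX[symmetric] det_mul abc r by simp
    moreover have "det G = 1 + (z + cnj z) - (G $ 1 $ 2 * G $ 2 $ 1 + G $ 1 $ 3 * G $ 3 $ 1 + G $ 2 $ 3 * G $ 3 $ 2)"
      by (simp add: det_3 Gjj) (simp add: G col z_def cnj_cinner)
    ultimately have "1 / 4 + (z + cnj z) = 0" by (simp add: G12 G13 G23 quarter)
    then have Re: "Re z = - 1 / 8" by (simp add: complex_eq_iff)
    have h: "cmod (cinner (\<psi> 1) (\<psi> 2)) = 1 / 2" "cmod (cinner (\<psi> 1) (\<psi> 3)) = 1 / 2"
      "cmod (cinner (\<psi> 2) (\<psi> 3)) = 1 / 2"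
      by (rule half; simp add: quarter)+
    have "cmod (cinner (\<psi> 3) (\<psi> 1)) = cmod (cinner (\<psi> 1) (\<psi> 3))"
      using complex_mod_cnj[of "cinner (\<psi> 1) (\<psi> 3)"] by (simp only: cnj_cinner)
    then have cz: "cmod z = 1 / 8"
      unfolding z_def norm_mult h by simp
    have "Im z = 0" using cmod_power2[of z] unfolding cz Re by (simp add: power_divide)
    then have z: "z = - 1 / 8" using Re by (simp add: complex_eq_iff)
    obtain V :: "complex ^ 2 ^ 'n" where V: "isometry V"
      "\<forall>i\<in>{1, 2, 3}. ketbra (\<psi> i) = V ** trine i ** dagger V"
      using trine_if_gram[OF \<psi>(1) h(1,2) z[unfolded z_def]] by blast
    have "dagger (mat 1 :: complex ^ 'n ^ 'n) = mat 1"
      using psd_one[where ?'n = 'n] unfolding psd_def by blast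
    \<comment> \<open>The isometry already sends each trine state to the state with the same label,
      so identities serve as the unitary and the permutation.\<close>
    then show ?thesis using V unitary_one \<psi>(2)
      by (intro exI[of _ V] exI[of _ "mat 1"] exI[of _ id]) (auto simp: permutes_id)
  qed
  then show ?thesis using order_trans[OF \<beta> bound(1)] by blast
qed

end
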